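(* Let $\Gamma$ be an infinite (countable, discrete) sofic group and let $\Sigma=(\sigma_i\colon\Gamma\to S_{d_i})_i$ be a sofic approximation of $\Gamma$. Then for every $1\le p\le\infty$ and every uniformly bounded representation of $\Gamma$ on a finite-dimensional Banach space $V$, $$\dim_{\Sigma,\ell^p}(V,\Gamma)=0.$$
   Context: All vector spaces are complex and $\Gamma$ is a countable discrete group. Sofic approximation: $S_n$ is the group of bijections of $\{1,\dots,n\}$ and $d_{\mathrm{Hamm}}(\sigma,\tau)=\frac1n|\{j:\sigma(j)\ne\tau(j)\}|$. A sofic approximation of $\Gamma$ is a sequence of functions $\sigma_i\colon\Gamma\to S_{d_i}$ (not assumed homomorphisms) with $\sigma_i(e)=1$, $d_{\mathrm{Hamm}}(\sigma_i(gh),\sigma_i(g)\sigma_i(h))\to0$ for all $g,h\in\Gamma$, and $d_{\mathrm{Hamm}}(\sigma_i(g),\sigma_i(h))\to1$ for all $g\neq h$. $\Gamma$ is sofic if it has a sofic approximation. Dimension: An action of $\Gamma$ on a Banach space $V$ by bounded linear operators is uniformly bounded if the operator norms of the elements $g\in\Gamma$ are uniformly bounded. $\mathrm{Isom}(W)$ is the group of linear surjective isometries of $W$. Let $\Sigma=(\sigma_i\colon\Gamma\to\mathrm{Isom}(V_i))_i$ be a sequence of maps with $0<\dim V_i<\infty$, and let $\Gamma$ have a uniformly bounded action on a separable Banach space $V$. Let $S=(x_j)_{j=1}^\infty$ be a bounded sequence in $V$ that is dynamically generating, i.e. $\overline{\mathrm{span}}\{gx_j:g\in\Gamma,j\in\mathbb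 N\}=V$. For $F\subseteq\Gamma$ finite with $e\in F$, $m\in\mathbb N$, $\delta>0$ let $V_{F,m}=\mathrm{span}\{g_1\cdots g_kx_j: g_1,\dots,g_k\in F,\ 1\le j,k\le m\}$ and let $\mathrm{Hom}_\Gamma(S,F,m,\delta,\sigma_i)$ be the set of linear maps $T\colon V_{F,m}\to V_i$ with $\|T\|\le1$ and $\|T(g_1\cdots g_kx_j)-\sigma_i(g_1)\cdots\sigma_i(g_k)T(x_j)\|<\delta$ for all $g_1,\dots,g_k\in F$, $1\le j,k\le m$. Define $\alpha_S(T)\in\ell^\infty(\mathbb N,V_i)$ by $\alpha_S(T)(n)=T(x_n)$ for $n\le m$ and $\alpha_S(T)(n)=0$ for $n>m$. A product norm is a norm $\rho$ on $\ell^\infty(\mathbb N)$ with $\rho(f)\le\rho(g)$ whenever $|f|\le|g|$ and which induces the topology of pointwise convergence on $\{f:\|f\|_\infty\le1\}$; put $\rho_{V_i}(f)=\rho((\|f(n)\|)_n)$ for $f\in\ell^\infty(\mathbb N,V_i)$. For a subset $A$ of a vector space with pseudonorm $\rho$, $d_\varepsilon(A,\rho)$ is the smallest dimension of a linear subspace $W$ such that every $x\in A$ has some $w\in W$ with $\rho(x-w)<\varepsilon$. Then $$\dim_\Sigma(V,\Gamma)=\sup_{\varepsilon>0}\ \limsup_{(F,m,\delta)}\ \limsup_{i\to\infty}\frac1{\dim V_i}\,d_\varepsilon\big(\alpha_S(\mathrm{Hom}_\Gamma(S,F,m,\delta,\sigma_i)),\rho_{V_i}\big),$$ where triples are directed by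 $(F,m,\delta)\le(F',m',\delta')$ iff $F\subseteq F'$, $m\le m'$, $\delta'\le\delta$, and $\limsup$ over the directed set means the infimum over triples $t_0$ of the supremum over triples $t\ge t_0$. It is known that this is independent of the choice of $S$ and $\rho$. $\ell^p$-version: for a sofic approximation $\Sigma=(\sigma_i\colon\Gamma\to S_{d_i})$, let $V_i=\ell^p(\{1,\dots,d_i\})$, let $S_{d_i}$ act isometrically on $V_i$ by permutations, $(\sigma f)(j)=f(\sigma^{-1}(j))$, and let $\widetilde\Sigma=(\widetilde\sigma_i\colon\Gamma\to\mathrm{Isom}(\ell^p(\{1,\dots,d_i\})))_i$ be given by $(\widetilde\sigma_i(g)f)(j)=f(\sigma_i(g)^{-1}(j))$. Then $$\dim_{\Sigma,\ell^p}(V,\Gamma)=\dim_{\widetilde\Sigma}(V,\Gamma)=\sup_{\varepsilon>0}\ \limsup_{(F,m,\delta)}\ \limsup_{i\to\infty}\frac1{d_i}\,d_\varepsilon\big(\alpha_S(\mathrm{Hom}_\Gamma(S,F,m,\delta,\widetilde\sigma_i)),\rho_{\ell^p(\{1,\dots,d_i\})}\big).$$ *)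

theory Defs
  imports "HOL-Analysis.Analysis" "HOL-Library.Function_Algebras"
    "HOL-Combinatorics.Permutations" "HOL-Algebra.Group_Action"
begin

section \<open>Complex vector spaces and complex Banach spaces\<close>

class complex_vector = ab_group_add +
  fixes scaleC :: "complex \<Rightarrow> 'a \<Rightarrow> 'a"  (infixr \<open>*\<^sub>C\<close> 75)
  assumes scaleC_add_right: "a *\<^sub>C (x + y) = a *\<^sub>C x + a *\<^sub>C y"
    and scaleC_add_left: "(a + b) *\<^sub>C x = a *\<^sub>C x + b *\<^sub>C x"
    and scaleC_scaleC: "a *\<^sub>C (b *\<^sub>C x) = (a * b) *\<^sub>C x"
    and scaleC_one: "1 *\<^sub>C x = x"

global_interpretation complex_vector: vector_space "scaleC :: complex \<Rightarrow> 'a \<Rightarrow> 'a::complex_vector"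
  by unfold_locales (fact scaleC_add_right scaleC_add_left scaleC_scaleC scaleC_one)+

class complex_normed_vector = complex_vector + real_normed_vector +
  assumes scaleR_scaleC: "r *\<^sub>R x = complex_of_real r *\<^sub>C x"
    and norm_scaleC: "norm (a *\<^sub>C x) = cmod a * norm x"

class complex_banach = complex_normed_vector + banach

instantiation complex :: complex_vector
begin

definition scaleC_complex :: "complex \<Rightarrow> complex \<Rightarrow> complex"
  where "scaleC_complex a z = a * z"

instance
  by standard (simp_all add: scaleC_complex_def algebra_simps)

end

instantiation "fun" :: (type, complex_vector) complex_vector
begin

definition scaleC_fun :: "complex \<Rightarrow> ('a \<Rightarrow> 'b) \<Rightarrow> 'a \<Rightarrow> 'b"
  where "scaleC_fun a f = (\<lambda>x. a *\<^sub>C f x)"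

instance
  by standard (simp_all add: scaleC_fun_def fun_eq_iff scaleC_add_right scaleC_add_left
      scaleC_scaleC scaleC_one)

end

text \<open>
  Note that \<open>complex_vector.dim\<close> is \<open>0\<close> on infinite-dimensional
  subspaces, so it is only used below together with this predicate.
\<close>

definition fin_dim :: "'a::complex_vector set \<Rightarrow> bool"
  where "fin_dim U \<longleftrightarrow> (\<exists>B. finite B \<and> complex_vector.span B = U)"

definition complex_linear_on :: "'a::complex_vector set \<Rightarrow> ('a \<Rightarrow> 'b::complex_vector) \<Rightarrow> bool"
  where "complex_linear_on U T \<longleftrightarrow>
    (\<forall>u\<in>U. \<forall>v\<in>U. T (u + v) = T u + T v) \<and> (\<forall>a. \<forall>u\<in>U. T (a *\<^sub>C u) = a *\<^sub>C T u)"


section \<open>Sofic approximations\<close>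

definition hamming_dist :: "nat \<Rightarrow> (nat \<Rightarrow> nat) \<Rightarrow> (nat \<Rightarrow> nat) \<Rightarrow> real"
  where "hamming_dist n \<sigma> \<tau> = real (card {j \<in> {1..n}. \<sigma> j \<noteq> \<tau> j}) / real n"

definition sofic_approximation ::
    "('g, 'm) monoid_scheme \<Rightarrow> (nat \<Rightarrow> nat) \<Rightarrow> (nat \<Rightarrow> 'g \<Rightarrow> nat \<Rightarrow> nat) \<Rightarrow> bool"
  where "sofic_approximation G d \<sigma> \<longleftrightarrow>
    (\<forall>i. 0 < d i) \<and>
    (\<forall>i. \<forall>g\<in>carrier G. \<sigma> i g permutes {1..d i}) \<and>
    (\<forall>i. \<sigma> i \<one>\<^bsub>G\<^esub> = id) \<and>
    (\<forall>g\<in>carrier G. \<forall>h\<in>carrier G.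
      (\<lambda>i. hamming_dist (d i) (\<sigma> i (g \<otimes>\<^bsub>G\<^esub> h)) (\<sigma> i g \<circ> \<sigma> i h)) \<longlonglongrightarrow> 0) \<and>
    (\<forall>g\<in>carrier G. \<forall>h\<in>carrier G. g \<noteq> h \<longrightarrow>
      (\<lambda>i. hamming_dist (d i) (\<sigma> i g) (\<sigma> i h)) \<longlonglongrightarrow> 1)"

definition sofic_group :: "('g, 'm) monoid_scheme \<Rightarrow> bool"
  where "sofic_group G \<longleftrightarrow> group G \<and> countable (carrier G) \<and> (\<exists>d \<sigma>. sofic_approximation G d \<sigma>)"


section \<open>Uniformly bounded actions\<close>

definition uniformly_bounded_action ::
    "('g, 'm) monoid_scheme \<Rightarrow> ('g \<Rightarrow> 'v \<Rightarrow> 'v::complex_normed_vector) \<Rightarrow> bool"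
  where "uniformly_bounded_action G \<pi> \<longleftrightarrow>
    group_action G UNIV \<pi> \<and>
    (\<forall>g\<in>carrier G. bounded_linear (\<pi> g) \<and> complex_linear_on UNIV (\<pi> g)) \<and>
    (\<exists>C. \<forall>g\<in>carrier G. onorm (\<pi> g) \<le> C)"

text \<open>
  Sequences indexed by the positive integers are indexed by \<open>nat\<close> from \<open>0\<close> here, so that
  \<open>x j\<close> is $x_{j+1}$ and the range $1 \le j \le m$ becomes \<open>j < m\<close>.
\<close>

definition dynamically_generating ::
    "('g, 'm) monoid_scheme \<Rightarrow> ('g \<Rightarrow> 'v \<Rightarrow> 'v::complex_normed_vector) \<Rightarrow> (nat \<Rightarrow> 'v) \<Rightarrow> bool"
  where "dynamically_generating G \<pi> x \<longleftrightarrow>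
    closure (complex_vector.span {\<pi> g (x j) | g j. g \<in> carrier G}) = UNIV"


section \<open>Product norms and \<open>\<epsilon>\<close>-dimension\<close>

definition norm_on :: "'a::complex_vector set \<Rightarrow> ('a \<Rightarrow> real) \<Rightarrow> bool"
  where "norm_on X N \<longleftrightarrow>
    (\<forall>u\<in>X. 0 \<le> N u) \<and>
    (\<forall>u\<in>X. N u = 0 \<longleftrightarrow> u = 0) \<and>
    (\<forall>u\<in>X. \<forall>a. N (a *\<^sub>C u) = cmod a * N u) \<and>
    (\<forall>u\<in>X. \<forall>v\<in>X. N (u + v) \<le> N u + N v)"

definition linf :: "'w set \<Rightarrow> ('w \<Rightarrow> real) \<Rightarrow> (nat \<Rightarrow> 'w) set"
  where "linf W N = {f. (\<forall>n. f n \<in> W) \<and> (\<exists>C. \<forall>n. N (f n) \<le> C)}"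

text \<open>
  The last clause below says that the metric \<open>\<rho> (f - g)\<close> has the same open sets on the closed
  unit ball of $\ell^\infty$ as pointwise convergence; \<open>\<rho>\<close> is unconstrained off $\ell^\infty$.
\<close>

definition product_norm :: "((nat \<Rightarrow> complex) \<Rightarrow> real) \<Rightarrow> bool"
  where "product_norm \<rho> \<longleftrightarrow>
    norm_on (linf UNIV cmod) \<rho> \<and>
    (\<forall>f\<in>linf UNIV cmod. \<forall>g\<in>linf UNIV cmod. (\<forall>n. cmod (f n) \<le> cmod (g n)) \<longrightarrow> \<rho> f \<le> \<rho> g) \<and>
    (let B = {f. \<forall>n. cmod (f n) \<le> 1} in
      \<forall>U\<subseteq>B. openin (subtopology (product_topology (\<lambda>_. euclidean) UNIV) B) U \<longleftrightarrow>
        (\<forall>f\<in>U. \<exists>r>0. \<forall>g\<in>B. \<rho> (f - g) < r \<longrightarrow> g \<in> U))"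

definition vector_product_norm ::
    "((nat \<Rightarrow> complex) \<Rightarrow> real) \<Rightarrow> ('w \<Rightarrow> real) \<Rightarrow> (nat \<Rightarrow> 'w) \<Rightarrow> real"
  where "vector_product_norm \<rho> N f = \<rho> (\<lambda>n. complex_of_real (N (f n)))"

text \<open>
  The least dimension of a linear subspace of the ambient space \<open>X\<close> that \<open>\<epsilon>\<close>-contains \<open>A\<close>,
  and \<open>\<infinity>\<close> if no finite-dimensional subspace does.
\<close>

definition eps_dim ::
    "real \<Rightarrow> 'a::complex_vector set \<Rightarrow> 'a set \<Rightarrow> ('a \<Rightarrow> real) \<Rightarrow> ereal"
  where "eps_dim \<epsilon> X A r =
    (INF U \<in> {U. complex_vector.subspace U \<and> U \<subseteq> X \<and> fin_dim U \<and>
                 (\<forall>a\<in>A. \<exists>u\<in>U. r (a - u) < \<epsilon>)}.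
      ereal (real (complex_vector.dim U)))"


section \<open>The dimension of an action\<close>

text \<open>
  A finite-dimensional normed space $V_i$ is given by a subspace \<open>W\<close> of a type together
  with a norm \<open>N\<close> on it, and \<open>s\<close> is a map from the group to the linear isometries of \<open>W\<close>.
  The product $g_1 \cdots g_k$ applied to \<open>v\<close> is \<open>foldr \<pi> [g\<^sub>1, \<dots>, g\<^sub>k] v\<close>.
\<close>

definition words :: "'g set \<Rightarrow> nat \<Rightarrow> 'g list set"
  where "words F m = {gs. set gs \<subseteq> F \<and> 1 \<le> length gs \<and> length gs \<le> m}"

definition word_span ::
    "('g \<Rightarrow> 'v \<Rightarrow> 'v::complex_vector) \<Rightarrow> (nat \<Rightarrow> 'v) \<Rightarrow> 'g set \<Rightarrow> nat \<Rightarrow> 'v set"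
  where "word_span \<pi> x F m =
    complex_vector.span {foldr \<pi> gs (x j) | gs j. gs \<in> words F m \<and> j < m}"

definition Hom_almost ::
    "('g \<Rightarrow> 'v \<Rightarrow> 'v::complex_normed_vector) \<Rightarrow> (nat \<Rightarrow> 'v) \<Rightarrow> 'g set \<Rightarrow> nat \<Rightarrow> real \<Rightarrow>
     'w::complex_vector set \<Rightarrow> ('w \<Rightarrow> real) \<Rightarrow> ('g \<Rightarrow> 'w \<Rightarrow> 'w) \<Rightarrow> ('v \<Rightarrow> 'w) set"
  where "Hom_almost \<pi> x F m \<delta> W N s =
    {T \<in> word_span \<pi> x F m \<rightarrow>\<^sub>E W.
      complex_linear_on (word_span \<pi> x F m) T \<and>
      (\<forall>v\<in>word_span \<pi> x F m. N (T v) \<le> norm v) \<and>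
      (\<forall>gs\<in>words F m. \<forall>j<m. N (T (foldr \<pi> gs (x j)) - foldr s gs (T (x j))) < \<delta>)}"

definition alpha_map :: "(nat \<Rightarrow> 'v) \<Rightarrow> nat \<Rightarrow> ('v \<Rightarrow> 'w::zero) \<Rightarrow> nat \<Rightarrow> 'w"
  where "alpha_map x m T = (\<lambda>n. if n < m then T (x n) else 0)"

definition triples :: "('g, 'm) monoid_scheme \<Rightarrow> ('g set \<times> nat \<times> real) set"
  where "triples G = {(F, m, \<delta>). finite F \<and> F \<subseteq> carrier G \<and> \<one>\<^bsub>G\<^esub> \<in> F \<and> 1 \<le> m \<and> 0 < \<delta>}"

definition triple_le :: "'g set \<times> nat \<times> real \<Rightarrow> 'g set \<times> nat \<times> real \<Rightarrow> bool"
  where "triple_le t t' \<longleftrightarrow> (case (t, t') of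
    ((F, m, \<delta>), (F', m', \<delta>')) \<Rightarrow> F \<subseteq> F' \<and> m \<le> m' \<and> \<delta>' \<le> \<delta>)"

definition limsup_triples ::
    "('g, 'm) monoid_scheme \<Rightarrow> ('g set \<Rightarrow> nat \<Rightarrow> real \<Rightarrow> ereal) \<Rightarrow> ereal"
  where "limsup_triples G \<phi> =
    (INF t0 \<in> triples G. SUP (F, m, \<delta>) \<in> {t \<in> triples G. triple_le t0 t}. \<phi> F m \<delta>)"

text \<open>
  The generating sequence \<open>x\<close> and the product norm \<open>\<rho>\<close> are kept as parameters; the value is known
  not to depend on them when \<open>x\<close> is bounded and dynamically generating.
\<close>

definition dim_Sigma ::
    "('g, 'm) monoid_scheme \<Rightarrow> ('g \<Rightarrow> 'v \<Rightarrow> 'v::complex_normed_vector) \<Rightarrow> (nat \<Rightarrow> 'v) \<Rightarrow>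
     ((nat \<Rightarrow> complex) \<Rightarrow> real) \<Rightarrow>
     (nat \<Rightarrow> 'w::complex_vector set) \<Rightarrow> (nat \<Rightarrow> 'w \<Rightarrow> real) \<Rightarrow> (nat \<Rightarrow> 'g \<Rightarrow> 'w \<Rightarrow> 'w) \<Rightarrow> ereal"
  where "dim_Sigma G \<pi> x \<rho> W N s =
    (SUP \<epsilon> \<in> {0<..}. limsup_triples G (\<lambda>F m \<delta>. limsup (\<lambda>i.
      eps_dim \<epsilon> (linf (W i) (N i))
        (alpha_map x m ` Hom_almost \<pi> x F m \<delta> (W i) (N i) (s i))
        (vector_product_norm \<rho> (N i))
      / ereal (real (complex_vector.dim (W i))))))"


section \<open>The \<open>\<ell>\<^sup>p\<close>-version\<close>

text \<open>
  $\ell^p(\{1,\dots,d\})$ is realised as the functions on \<open>nat\<close> vanishing outside \<open>{1..d}\<close>;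
  the norm is only meaningful for \<open>d > 0\<close> and \<open>1 \<le> p\<close>.
\<close>

definition lp_space :: "nat \<Rightarrow> (nat \<Rightarrow> complex) set"
  where "lp_space d = {f. \<forall>j. j \<notin> {1..d} \<longrightarrow> f j = 0}"

definition lp_norm :: "ereal \<Rightarrow> nat \<Rightarrow> (nat \<Rightarrow> complex) \<Rightarrow> real"
  where "lp_norm p d f =
    (if p = \<infinity> then Max ((\<lambda>j. cmod (f j)) ` {1..d})
     else (\<Sum>j\<in>{1..d}. cmod (f j) powr real_of_ereal p) powr (1 / real_of_ereal p))"

definition perm_op :: "(nat \<Rightarrow> nat) \<Rightarrow> (nat \<Rightarrow> complex) \<Rightarrow> nat \<Rightarrow> complex"
  where "perm_op \<tau> f = (\<lambda>j. f (inv_into UNIV \<tau> j))"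

definition dim_Sigma_lp ::
    "('g, 'm) monoid_scheme \<Rightarrow> ('g \<Rightarrow> 'v \<Rightarrow> 'v::complex_normed_vector) \<Rightarrow> (nat \<Rightarrow> 'v) \<Rightarrow>
     ((nat \<Rightarrow> complex) \<Rightarrow> real) \<Rightarrow> ereal \<Rightarrow> (nat \<Rightarrow> nat) \<Rightarrow> (nat \<Rightarrow> 'g \<Rightarrow> nat \<Rightarrow> nat) \<Rightarrow> ereal"
  where "dim_Sigma_lp G \<pi> x \<rho> p d \<sigma> =
    dim_Sigma G \<pi> x \<rho> (\<lambda>i. lp_space (d i)) (\<lambda>i. lp_norm p (d i)) (\<lambda>i g. perm_op (\<sigma> i g))"

end

theory Submission
  imports Defs
begin

text \<open>
  The image of \<open>\<Gamma>\<close> in the operators on a finite-dimensional \<open>V\<close> is bounded, hence totally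
  bounded, so infinitely many group elements act within \<open>\<delta>\<close> of the identity. Fix \<open>N\<close> of
  them. For an almost equivariant contraction \<open>T\<close> each vector \<open>T (x n)\<close> is then almost
  invariant under \<open>N\<close> permutations of \<open>{1..d}\<close>, which by soficity send all but few points to
  \<open>N\<close> distinct points. A maximal family of disjoint stars \<open>{\<sigma> a j | a}\<close> has at most
  \<open>d / N\<close> members, and every remaining good point is two steps away from a centre; hence
  \<open>T (x n)\<close> is close in \<open>\<ell>\<^sup>p\<close> to a function constant on at most \<open>d / N + o(d)\<close>
  clusters. Since the product norm only sees \<open>K\<close> coordinates up to \<open>\<epsilon>\<close>, with \<open>K\<close> chosen
  before \<open>N\<close>, the normalised dimension is at most \<open>K / N\<close>.
\<close>

section \<open>Compact balls in finite dimension and group elements acting near the identity\<close>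

text \<open>By induction on \<open>B\<close>: the old span is closed because its bounded pieces are
  compact, so a new vector \<open>b\<close> outside it has positive distance \<open>c\<close> from
  it. This distance controls the coefficient of \<open>b\<close>, and the new piece is cut out of a
  continuous image of a compact product.\<close>

lemma compact_span_Int_cball:
  fixes B :: "'v::complex_normed_vector set"
  assumes "finite B"
  shows "compact (complex_vector.span B \<inter> cball 0 R)"
  using assms
proof (induction B arbitrary: R)
  case empty
  then show ?case by (auto intro!: finite_imp_compact)
next
  case (insert b B)
  let ?S = "complex_vector.span B"
  show ?case
  proof (cases "b \<in> ?S")
    case True
    then show ?thesis using insert.IH by (simp add: complex_vector.span_redundant)
  next
    case False
    have cl: "closed ?S"
      unfolding closed_sequential_limits
    proof (intro allI impI)
      fix s l assume s: "(\<forall>n. s n \<in> ?S) \<and> s \<longlonglongrightarrow> l"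
      then have "bounded (range s)"
        using convergent_imp_bounded by blast
      then obtain M where M: "\<And>n. norm (s n) \<le> M"
        by (auto simp: bounded_iff)
      have "closed (?S \<inter> cball 0 M)"
        using insert.IH compact_imp_closed by blast
      then show "l \<in> ?S"
        using s M closed_sequentially[of "?S \<inter> cball 0 M" s l] by auto
    qed
    define c where "c = infdist b ?S"
    have c: "c > 0"
      unfolding c_def using cl False complex_vector.span_zero[of B]
      by (intro infdist_pos_not_in_closed) auto
    \<comment> \<open>The radii are forced: \<open>R / c\<close> bounds the coefficient of
      \<open>b\<close>, and the triangle inequality then bounds the remainder.\<close>
    define K where "K = (\<lambda>(a, w). a *\<^sub>C b + w) `
      (cball 0 (R / c) \<times> (?S \<inter> cball 0 (R + R / c * norm b)))"
    have blin: "bounded_linear (\<lambda>a. a *\<^sub>C b)"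
      by (rule bounded_linear_intro[where K = "norm b"])
        (simp_all add: scaleC_add_left norm_scaleC scaleR_scaleC scaleC_scaleC scaleR_conv_of_real)
    have "compact K"
      unfolding K_def
    proof (rule compact_continuous_image)
      show "continuous_on (cball 0 (R / c) \<times> (?S \<inter> cball 0 (R + R / c * norm b)))
          (\<lambda>(a, w). a *\<^sub>C b + w)"
        unfolding case_prod_beta
        by (intro continuous_intros bounded_linear.continuous_on[OF blin])
    qed (intro compact_Times insert.IH compact_cball)
    moreover have "complex_vector.span (insert b B) \<inter> cball 0 R = K \<inter> cball 0 R"
    proof (intro equalityI subsetI)
      fix v assume v: "v \<in> complex_vector.span (insert b B) \<inter> cball 0 R"
      then obtain a where w: "v - a *\<^sub>C b \<in> ?S"
        by (auto simp: complex_vector.span_insert)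
      have nv: "norm v \<le> R" using v by simp
      have a: "cmod a * c \<le> norm v"
      proof (cases "a = 0")
        case False
        \<comment> \<open>Dividing by \<open>- a\<close> turns the remainder into a point of
          \<open>?S\<close> at distance \<open>norm v / cmod a\<close> from
          \<open>b\<close>.\<close>
        have "- inverse a *\<^sub>C (v - a *\<^sub>C b) \<in> ?S"
          by (rule complex_vector.span_scale[OF w])
        then have "c \<le> dist b (- inverse a *\<^sub>C (v - a *\<^sub>C b))"
          unfolding c_def by (rule infdist_le)
        also have "b - (- inverse a *\<^sub>C (v - a *\<^sub>C b)) = inverse a *\<^sub>C v"
          using False by (simp add: complex_vector.scale_right_diff_distrib scaleC_scaleC scaleC_one)
        then have "dist b (- inverse a *\<^sub>C (v - a *\<^sub>C b)) = norm v / cmod a"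
          by (simp add: dist_norm norm_scaleC norm_inverse divide_inverse mult.commute)
        finally show ?thesis using False by (simp add: field_simps)
      qed simp
      then have a': "cmod a \<le> R / c"
        using nv c by (simp add: pos_le_divide_eq)
      have "norm (v - a *\<^sub>C b) \<le> norm v + cmod a * norm b"
        by (metis norm_scaleC norm_triangle_ineq4)
      also have "\<dots> \<le> R + R / c * norm b"
        using nv a' by (intro add_mono mult_right_mono) auto
      finally have "(a, v - a *\<^sub>C b) \<in> cball 0 (R / c) \<times> (?S \<inter> cball 0 (R + R / c * norm b))"
        using a' w by auto
      then have "v \<in> K" unfolding K_def by (rule rev_image_eqI) simp
      then show "v \<in> K \<inter> cball 0 R" using v by simp
    next
      fix v assume "v \<in> K \<inter> cball 0 R"
      then show "v \<in> complex_vector.span (insert b B) \<inter> cball 0 R"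
        by (auto simp: K_def complex_vector.span_insert)
           (metis add_diff_cancel_left')
    qed
    ultimately show ?thesis by (metis compact_Int_closed closed_cball)
  qed
qed

lemma compact_cball_fin_dim:
  assumes "fin_dim (UNIV :: 'v::complex_normed_vector set)"
  shows "compact (cball (0::'v) R)"
proof -
  obtain B :: "'v set" where "finite B" "complex_vector.span B = UNIV"
    using assms by (auto simp: fin_dim_def)
  then show ?thesis using compact_span_Int_cball[of B R] by simp
qed

text \<open>A pigeonhole argument: rounding \<open>\<pi> g\<close> on a finite net \<open>Y\<close>
  to values in a finite net \<open>Z\<close> leaves finitely many tables, so infinitely many
  \<open>g\<close> share the table of some \<open>g0\<close>. By the uniform bound, the inverse of
  \<open>g0\<close> times such a \<open>g\<close> is nearly trivial on the ball, and left
  translation is injective.\<close>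

lemma infinite_near_identity:
  fixes \<pi> :: "'g \<Rightarrow> 'v \<Rightarrow> 'v::complex_normed_vector"
  assumes "group G" "infinite (carrier G)" "fin_dim (UNIV :: 'v set)"
    and act: "uniformly_bounded_action G \<pi>" and "\<eta> > 0"
  shows "infinite {h \<in> carrier G. \<forall>v\<in>cball 0 R. norm (\<pi> h v - v) \<le> \<eta>}"
proof -
  interpret group G by fact
  have ga: "group_action G UNIV \<pi>" and
    lin: "\<And>g. g \<in> carrier G \<Longrightarrow> bounded_linear (\<pi> g)"
    using act by (auto simp: uniformly_bounded_action_def)
  obtain C0 where C0: "\<And>g. g \<in> carrier G \<Longrightarrow> onorm (\<pi> g) \<le> C0"
    using act by (auto simp: uniformly_bounded_action_def)
  define C where "C = max C0 1"
  have C: "norm (\<pi> g v) \<le> C * norm v" if "g \<in> carrier G" for g v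
  proof -
    have "onorm (\<pi> g) * norm v \<le> C * norm v"
      using C0[OF that] by (intro mult_right_mono) (auto simp: C_def)
    then show ?thesis using onorm[OF lin[OF that], of v] by linarith
  qed
  have C1: "C \<ge> 1" by (simp add: C_def)
  \<comment> \<open>Chosen so that \<open>C * ((2 * C + 2) * e) = \<eta>\<close>: moving
    \<open>v\<close> to the net costs \<open>C * e\<close> for each of \<open>g\<close> and
    \<open>g0\<close>, rounding costs \<open>e\<close> for each, and applying the inverse of
    \<open>g0\<close> costs a factor \<open>C\<close>.\<close>
  define e where "e = \<eta> / (C * (2 * C + 2))"
  have e: "e > 0" using \<open>\<eta> > 0\<close> C1 by (auto simp: e_def intro!: divide_pos_pos)
  obtain Y where Y: "finite Y" "cball (0::'v) R \<subseteq> (\<Union>y\<in>Y. ball y e)"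
    using compact_cball_fin_dim[OF assms(3)] e unfolding compact_eq_totally_bounded by blast
  \<comment> \<open>The points of \<open>Y\<close> need not lie in the ball they cover, so their
    norms get a separate bound.\<close>
  define D where "D = (\<Sum>y\<in>Y. norm y)"
  have D: "norm y \<le> D" if "y \<in> Y" for y
    unfolding D_def by (rule member_le_sum[OF that]) (use Y in auto)
  obtain Z where Z: "finite Z" "cball (0::'v) (C * D) \<subseteq> (\<Union>y\<in>Z. ball y e)"
    using compact_cball_fin_dim[OF assms(3)] e unfolding compact_eq_totally_bounded by blast
  have "\<exists>z\<in>Z. norm (\<pi> g y - z) < e" if "g \<in> carrier G" "y \<in> Y" for g y
  proof -
    have "norm (\<pi> g y) \<le> C * D"
      using C[OF that(1), of y] D[OF that(2)] C1 mult_left_mono[of "norm y" D C] by linarith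
    then have "\<pi> g y \<in> cball 0 (C * D)" by simp
    then obtain z where "z \<in> Z" "\<pi> g y \<in> ball z e" using Z(2) by blast
    then show ?thesis by (auto simp: dist_norm norm_minus_commute)
  qed
  then obtain q where q: "\<And>g y. g \<in> carrier G \<Longrightarrow> y \<in> Y \<Longrightarrow> q g y \<in> Z \<and> norm (\<pi> g y - q g y) < e"
    by metis
  \<comment> \<open>Restricting to \<open>Y\<close> places the tables in a finite extensional
    function space.\<close>
  define Q where "Q g = restrict (q g) Y" for g
  have "Q ` carrier G \<subseteq> Y \<rightarrow>\<^sub>E Z"
    using q by (auto simp: Q_def)
  then have "finite (Q ` carrier G)"
    using finite_PiE[OF Y(1), of "\<lambda>_. Z"] Z(1) finite_subset by blast
  then obtain g0 where g0: "g0 \<in> carrier G" "infinite {g \<in> carrier G. Q g = Q g0}"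
    using pigeonhole_infinite[OF assms(2)] by blast
  let ?f = "\<lambda>g. inv\<^bsub>G\<^esub> g0 \<otimes>\<^bsub>G\<^esub> g"
  have "inj_on ?f {g \<in> carrier G. Q g = Q g0}"
    using g0(1) by (auto simp: inj_on_def)
  then have "infinite (?f ` {g \<in> carrier G. Q g = Q g0})"
    using g0(2) finite_imageD by blast
  moreover have "?f ` {g \<in> carrier G. Q g = Q g0} \<subseteq>
      {h \<in> carrier G. \<forall>v\<in>cball 0 R. norm (\<pi> h v - v) \<le> \<eta>}"
  proof safe
    fix g assume g: "g \<in> carrier G" "Q g = Q g0"
    show "?f g \<in> carrier G" using g0 g by simp
    fix v :: 'v assume "v \<in> cball 0 R"
    then obtain y where y: "y \<in> Y" "norm (v - y) < e"
      using Y(2) by (force simp: dist_norm norm_minus_commute)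
    have qq: "q g y = q g0 y" using g(2) y(1) by (metis Q_def restrict_apply')
    interpret \<pi>g: bounded_linear "\<pi> g" by (rule lin[OF g(1)])
    interpret \<pi>g0: bounded_linear "\<pi> g0" by (rule lin[OF g0(1)])
    have i: "inv\<^bsub>G\<^esub> g0 \<in> carrier G" using g0 by simp
    interpret \<pi>i: bounded_linear "\<pi> (inv\<^bsub>G\<^esub> g0)" by (rule lin[OF i])
    have "\<pi> g v - \<pi> g0 v = \<pi> g (v - y) - \<pi> g0 (v - y) + (\<pi> g y - q g y) - (\<pi> g0 y - q g0 y)"
      by (simp add: \<pi>g.diff \<pi>g0.diff qq)
    also have "norm \<dots> \<le> norm (\<pi> g (v - y)) + norm (\<pi> g0 (v - y)) + norm (\<pi> g y - q g y) + norm (\<pi> g0 y - q g0 y)"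
      by (smt (verit) norm_triangle_ineq norm_triangle_ineq4)
    also have "\<dots> \<le> C * e + C * e + e + e"
    proof (intro add_mono)
      show "norm (\<pi> g (v - y)) \<le> C * e" "norm (\<pi> g0 (v - y)) \<le> C * e"
        using C[OF g(1), of "v - y"] C[OF g0(1), of "v - y"] y(2) C1
          mult_left_mono[of "norm (v - y)" e C] by linarith+
      show "norm (\<pi> g y - q g y) \<le> e" "norm (\<pi> g0 y - q g0 y) \<le> e"
        using q[OF g(1) y(1)] q[OF g0(1) y(1)] by auto
    qed
    finally have *: "norm (\<pi> g v - \<pi> g0 v) \<le> (2 * C + 2) * e" by (simp add: algebra_simps)
    have comp: "\<pi> (inv\<^bsub>G\<^esub> g0 \<otimes>\<^bsub>G\<^esub> k) v = \<pi> (inv\<^bsub>G\<^esub> g0) (\<pi> k v)" if "k \<in> carrier G" for k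
      using group_action.composition_rule[OF ga _ i that] by simp
    have one: "\<pi> \<one>\<^bsub>G\<^esub> v = v"
      using fun_cong[OF group_action.id_eq_one[OF ga], of v] by simp
    have "\<pi> (?f g) v - v = \<pi> (inv\<^bsub>G\<^esub> g0) (\<pi> g v - \<pi> g0 v)"
      using comp[OF g(1)] comp[OF g0(1)] one g0(1) by (simp add: \<pi>i.diff)
    also have "norm \<dots> \<le> C * norm (\<pi> g v - \<pi> g0 v)" by (rule C[OF i])
    also have "\<dots> \<le> C * ((2 * C + 2) * e)" using * C1 by (intro mult_left_mono) auto
    also have "\<dots> = \<eta>" using C1 by (simp add: e_def)
    finally show "norm (\<pi> (?f g) v - v) \<le> \<eta>" .
  qed
  ultimately show ?thesis using finite_subset by blast
qed

section \<open>Product norms on bounded sequences\<close>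

text \<open>Inside the unit ball, a \<open>\<rho>\<close>-ball around 0 is open for pointwise
  convergence, so it contains a neighbourhood of 0 that restricts only finitely many coordinates.
  Scaling carries this to sequences bounded by \<open>C\<close>; coordinates from \<open>K\<close>
  on need no smallness.\<close>

lemma product_norm_small:
  assumes "product_norm \<rho>" "\<epsilon> > 0" "C > 0"
  obtains K r where "r > 0"
    "\<And>f. (\<And>n. 0 \<le> f n) \<Longrightarrow> (\<And>n. n < K \<Longrightarrow> f n \<le> r) \<Longrightarrow> (\<And>n. n \<ge> K \<Longrightarrow> f n \<le> C) \<Longrightarrow>
      \<rho> (\<lambda>n. complex_of_real (f n)) < \<epsilon>"
proof -
  define B where "B = {f :: nat \<Rightarrow> complex. \<forall>n. cmod (f n) \<le> 1}"
  have N: "norm_on (linf UNIV cmod) \<rho>"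
    and top: "\<And>U. U \<subseteq> B \<Longrightarrow> openin (subtopology (product_topology (\<lambda>_. euclidean) UNIV) B) U \<longleftrightarrow>
        (\<forall>f\<in>U. \<exists>r>0. \<forall>g\<in>B. \<rho> (f - g) < r \<longrightarrow> g \<in> U)"
    using assms(1) by (auto simp: product_norm_def B_def Let_def)
  have BL: "B \<subseteq> linf UNIV cmod" by (auto simp: B_def linf_def)
  have sc: "\<rho> (a *\<^sub>C u) = cmod a * \<rho> u" if "u \<in> linf UNIV cmod" for a u
    using N that by (auto simp: norm_on_def)
  have tri: "\<rho> (u + v) \<le> \<rho> u + \<rho> v" if "u \<in> linf UNIV cmod" "v \<in> linf UNIV cmod" for u v
    using N that by (auto simp: norm_on_def)
  have diffL: "f - g \<in> linf UNIV cmod" if fg: "f \<in> B" "g \<in> B" for f g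
  proof -
    have "cmod ((f - g) n) \<le> 2" for n
      using norm_triangle_ineq4[of "f n" "g n"] fg unfolding B_def by (smt (verit) mem_Collect_eq minus_apply)
    then show ?thesis by (auto simp: linf_def)
  qed
  define U where "U = {g \<in> B. \<rho> g < \<epsilon> / C}"
  have "0 \<in> B" by (simp add: B_def)
  then have z0: "\<rho> 0 = 0" "0 \<in> B" using N BL by (auto simp: norm_on_def)
  have "openin (subtopology (product_topology (\<lambda>_. euclidean) UNIV) B) U"
  proof (subst top)
    show "U \<subseteq> B" by (auto simp: U_def)
    show "\<forall>f\<in>U. \<exists>r>0. \<forall>g\<in>B. \<rho> (f - g) < r \<longrightarrow> g \<in> U"
    proof (intro ballI exI conjI impI)
      fix f assume f: "f \<in> U"
      then show "\<epsilon> / C - \<rho> f > 0" by (simp add: U_def)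
      fix g assume g: "g \<in> B" "\<rho> (f - g) < \<epsilon> / C - \<rho> f"
      have fB: "f \<in> B" using f by (simp add: U_def)
      \<comment> \<open>Homogeneity with factor -1 stands in for the symmetry of the
        distance.\<close>
      have "g = f + (- 1) *\<^sub>C (f - g)"
        by (simp add: fun_eq_iff scaleC_fun_def scaleC_complex_def)
      moreover have "(- 1) *\<^sub>C (f - g) \<in> linf UNIV cmod"
        using diffL[OF g(1) fB] by (simp add: complex_vector.scale_minus_left scaleC_one)
      ultimately have "\<rho> g \<le> \<rho> f + \<rho> ((- 1) *\<^sub>C (f - g))"
        using tri[of f "(- 1) *\<^sub>C (f - g)"] fB BL by (metis subsetD)
      also have "\<rho> ((- 1) *\<^sub>C (f - g)) = \<rho> (f - g)"
        using sc[OF diffL[OF fB g(1)], of "- 1"] by simp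
      finally show "g \<in> U" using g by (simp add: U_def)
    qed
  qed
  then obtain T where T: "openin (product_topology (\<lambda>_. euclidean) UNIV) T" "U = T \<inter> B"
    by (auto simp: openin_subtopology)
  have "0 \<in> U" using z0 assms by (simp add: U_def)
  then have "0 \<in> T" using T by blast
  have "\<exists>X. 0 \<in> Pi\<^sub>E UNIV X \<and> (\<forall>i. openin euclidean (X i)) \<and>
      finite {i. X i \<noteq> topspace euclidean} \<and> Pi\<^sub>E UNIV X \<subseteq> T"
    by (rule product_topology_open_contains_basis[OF T(1) \<open>0 \<in> T\<close>])
  then obtain X where X: "0 \<in> Pi\<^sub>E UNIV X" "\<And>i. open (X i)" "finite {i. X i \<noteq> UNIV}" "Pi\<^sub>E UNIV X \<subseteq> T"
    by (elim exE conjE) simp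
  have "\<exists>e>0. ball 0 e \<subseteq> X i" for i
  proof -
    have "0 \<in> X i" using PiE_mem[OF X(1), of i] by simp
    then show ?thesis using X(2)[of i] by (auto simp: open_contains_ball)
  qed
  then obtain e where e: "\<And>i. e i > 0" "\<And>i. ball 0 (e i) \<subseteq> X i" by metis
  obtain K where K: "\<And>i. X i \<noteq> UNIV \<Longrightarrow> i < K"
    using X(3) unfolding finite_nat_set_iff_bounded by auto
  \<comment> \<open>The extra 1 keeps the minimum defined when \<open>K = 0\<close> and ensures
    \<open>r \<le> C\<close>, so that the first coordinates also obey the bound
    \<open>C\<close>.\<close>
  define \<mu> where "\<mu> = Min (insert 1 (e ` {..<K}))"
  have \<mu>: "\<mu> > 0" "\<mu> \<le> 1" using e by (auto simp: \<mu>_def)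
  have \<mu>e: "\<mu> \<le> e i" if "i < K" for i
    unfolding \<mu>_def using that by (intro Min_le) auto
  \<comment> \<open>The half turns the non-strict bound by \<open>r\<close> into membership in the
    open balls.\<close>
  define r where "r = C * \<mu> / 2"
  have r: "r > 0" "r \<le> C" using \<mu> assms(3) by (simp_all add: r_def)
  show ?thesis
  proof (rule that[of r K])
    fix f :: "nat \<Rightarrow> real"
    assume f: "\<And>n. 0 \<le> f n" "\<And>n. n < K \<Longrightarrow> f n \<le> r" "\<And>n. n \<ge> K \<Longrightarrow> f n \<le> C"
    define g where "g n = complex_of_real (f n / C)" for n
    have fC: "f n \<le> C" for n using f(2,3)[of n] r by (cases "n < K") auto
    have gB: "g \<in> B" using f fC assms(3) by (simp add: B_def g_def norm_divide)
    have "g i \<in> X i" for i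
    proof (cases "X i = UNIV")
      case False
      then have "f i \<le> r" using K f(2) by blast
      moreover have "C * \<mu> \<le> C * e i" "0 < C * \<mu>"
        using \<mu>e[OF K[OF False]] \<mu> assms(3) by simp_all
      ultimately have "f i < C * e i" by (simp add: r_def)
      then have "f i / C < e i" using assms(3) by (simp add: field_simps)
      then have "g i \<in> ball 0 (e i)" using f assms(3) by (simp add: g_def norm_divide)
      then show ?thesis using e by blast
    qed simp
    then have "g \<in> U" using X(4) T(2) gB by auto
    then have "C * \<rho> g < \<epsilon>" using assms(3) by (simp add: U_def field_simps)
    moreover have "(\<lambda>n. complex_of_real (f n)) = complex_of_real C *\<^sub>C g"
      using assms(3) by (simp add: fun_eq_iff scaleC_fun_def scaleC_complex_def g_def)
    ultimately show "\<rho> (\<lambda>n. complex_of_real (f n)) < \<epsilon>"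
      using sc[of g "complex_of_real C"] gB BL assms(3) by auto
  qed (use r in auto)
qed

section \<open>Estimates for the l^p norm\<close>

text \<open>
  A crude substitute for Minkowski's inequality: the constant depends on the number of functions
  but not on \<open>d\<close> and \<open>p\<close>.
\<close>

lemma lp_norm_le:
  assumes "1 \<le> p" "0 < d" "finite I" "0 \<le> C" "0 \<le> t"
    and dom: "\<And>j. j \<in> {1..d} \<Longrightarrow> \<exists>k\<in>I. cmod (f j) \<le> C * cmod (h k j)"
    and h: "\<And>k. k \<in> I \<Longrightarrow> lp_norm p d (h k) \<le> t"
  shows "lp_norm p d f \<le> C * card I * t"
proof -
  have I: "card I \<ge> 1"
    using dom[of 1] \<open>0 < d\<close> \<open>finite I\<close> by (auto simp: Suc_le_eq card_gt_0_iff)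
  show ?thesis
  proof (cases "p = \<infinity>")
    case True
    have "cmod (f j) \<le> C * card I * t" if j: "j \<in> {1..d}" for j
    proof -
      obtain k where k: "k \<in> I" "cmod (f j) \<le> C * cmod (h k j)" using dom[OF j] by blast
      have "cmod (h k j) \<le> lp_norm p d (h k)"
        using j True by (simp add: lp_norm_def)
      then have "cmod (h k j) \<le> t" using h[OF k(1)] by simp
      then have "C * cmod (h k j) \<le> C * t" using \<open>0 \<le> C\<close> by (rule mult_left_mono)
      also have "\<dots> \<le> C * card I * t"
        using I mult_right_mono[of 1 "real (card I)" "C * t"] \<open>0 \<le> C\<close> \<open>0 \<le> t\<close>
        by (simp add: mult.assoc mult.left_commute)
      finally show ?thesis using k by simp
    qed
    then show ?thesis using True \<open>0 < d\<close> by (auto simp: lp_norm_def)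
  next
    case False
    define q where "q = real_of_ereal p"
    have q: "q \<ge> 1" using \<open>1 \<le> p\<close> False by (cases p) (auto simp: q_def)
    have lp: "lp_norm p d u = (\<Sum>j\<in>{1..d}. cmod (u j) powr q) powr (1 / q)" for u
      using False by (simp add: lp_norm_def q_def)
    have hq: "(\<Sum>j\<in>{1..d}. cmod (h k j) powr q) \<le> t powr q" if "k \<in> I" for k
    proof -
      have "((\<Sum>j\<in>{1..d}. cmod (h k j) powr q) powr (1 / q)) powr q \<le> t powr q"
        using h[OF that] q by (intro powr_mono2) (auto simp: lp)
      then show ?thesis using q by (simp add: powr_powr sum_nonneg)
    qed
    have "(\<Sum>j\<in>{1..d}. cmod (f j) powr q) \<le> (\<Sum>j\<in>{1..d}. \<Sum>k\<in>I. C powr q * cmod (h k j) powr q)"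
    proof (rule sum_mono)
      fix j assume "j \<in> {1..d}"
      then obtain k where k: "k \<in> I" "cmod (f j) \<le> C * cmod (h k j)" using dom by blast
      then have "cmod (f j) powr q \<le> C powr q * cmod (h k j) powr q"
        using q powr_mono2[of q "cmod (f j)" "C * cmod (h k j)"] by (simp add: powr_mult)
      also have "\<dots> \<le> (\<Sum>k\<in>I. C powr q * cmod (h k j) powr q)"
        using k(1) \<open>finite I\<close> by (intro member_le_sum[of k I "\<lambda>k. C powr q * cmod (h k j) powr q"]) auto
      finally show "cmod (f j) powr q \<le> (\<Sum>k\<in>I. C powr q * cmod (h k j) powr q)" .
    qed
    also have "\<dots> = (\<Sum>k\<in>I. C powr q * (\<Sum>j\<in>{1..d}. cmod (h k j) powr q))"
      by (subst sum.swap) (simp add: sum_distrib_left)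
    also have "\<dots> \<le> (\<Sum>k\<in>I. C powr q * t powr q)"
      using hq by (intro sum_mono mult_left_mono) auto
    also have "\<dots> = (C * t) powr q * card I" by (simp add: powr_mult)
    \<comment> \<open>As \<open>q \<ge> 1\<close>, enlarging \<open>card I\<close> to its
      \<open>q\<close>-th power lets the final root return a constant free of
      \<open>p\<close>.\<close>
    also have "\<dots> \<le> (C * t) powr q * card I powr q"
      using I q powr_mono[of 1 q "real (card I)"] by (intro mult_left_mono) auto
    also have "\<dots> = (C * card I * t) powr q" by (simp add: powr_mult)
    finally have "lp_norm p d f \<le> ((C * card I * t) powr q) powr (1 / q)"
      unfolding lp using q by (intro powr_mono2) (auto intro: sum_nonneg)
    then show ?thesis using q \<open>0 \<le> C\<close> \<open>0 \<le> t\<close> by (simp add: powr_powr)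
  qed
qed

text \<open>Pointwise the sum is at most twice the larger summand; the constant is this 2 times the
  number 2 of functions.\<close>

lemma lp_norm_add_le:
  assumes "1 \<le> p" "0 < d" "0 \<le> t" "lp_norm p d u \<le> t" "lp_norm p d v \<le> t"
  shows "lp_norm p d (u + v) \<le> 4 * t"
proof -
  have "lp_norm p d (u + v) \<le> 2 * real (card (UNIV :: bool set)) * t"
  proof (rule lp_norm_le[where h = "\<lambda>b. if b then u else v"])
    fix j
    show "\<exists>b\<in>UNIV. cmod ((u + v) j) \<le> 2 * cmod ((if b then u else v) j)"
      using norm_triangle_ineq[of "u j" "v j"]
      by (cases "cmod (u j) \<le> cmod (v j)") (auto intro: bexI[of _ True] bexI[of _ False])
  qed (use assms in auto)
  then show ?thesis by simp
qed

lemma lp_norm_permute: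
  assumes "s permutes {1..d}"
  shows "lp_norm p d (\<lambda>j. f (s j)) = lp_norm p d f"
proof -
  have "(\<lambda>j. cmod (f (s j))) ` {1..d} = (\<lambda>j. cmod (f j)) ` {1..d}"
    using permutes_image[OF assms] by (metis image_image)
  moreover have "(\<Sum>j\<in>{1..d}. cmod (f (s j)) powr q) = (\<Sum>j\<in>{1..d}. cmod (f j) powr q)" for q
    by (rule sum.permute[OF assms, symmetric, unfolded comp_def])
  ultimately show ?thesis by (simp add: lp_norm_def)
qed

lemma lp_norm_0:
  assumes "0 < d" shows "lp_norm p d 0 = 0"
  using assms by (auto simp: lp_norm_def)

lemma lp_norm_nonneg:
  assumes "0 < d" shows "0 \<le> lp_norm p d f"
proof (cases "p = \<infinity>")
  case True
  have "cmod (f d) \<le> Max ((\<lambda>j. cmod (f j)) ` {1..d})" using assms by (intro Max_ge) auto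
  then show ?thesis using True order.trans[OF norm_ge_zero[of "f d"]] by (simp add: lp_norm_def)
qed (simp add: lp_norm_def)

lemma sum_fun_apply: "sum f A x = (\<Sum>a\<in>A. f a x)" for f :: "'a \<Rightarrow> 'b \<Rightarrow> 'c::comm_monoid_add"
  by (induction A rule: infinite_finite_induct) auto

section \<open>Disjoint stars and coincidences of permutations\<close>

text \<open>Take \<open>M\<close> maximal among the sets of good points with pairwise disjoint
  stars. Each star has \<open>card A\<close> points, which bounds \<open>card M\<close>, and by
  maximality the star of every good point meets one with centre in \<open>M\<close>.\<close>

lemma disjoint_stars:
  fixes s :: "'a \<Rightarrow> 'b \<Rightarrow> 'b"
  assumes "finite X" "finite A" "A \<noteq> {}" and s: "\<And>a x. a \<in> A \<Longrightarrow> x \<in> X \<Longrightarrow> s a x \<in> X"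
    and good: "Y \<subseteq> X" "\<And>x. x \<in> Y \<Longrightarrow> inj_on (\<lambda>a. s a x) A"
  obtains M c where "M \<subseteq> Y" "card A * card M \<le> card X"
    "\<And>x. x \<in> Y \<Longrightarrow> c x \<in> M" "\<And>x. x \<in> Y \<Longrightarrow> \<exists>a\<in>A. \<exists>b\<in>A. s a x = s b (c x)"
proof -
  define st where "st x = (\<lambda>a. s a x) ` A" for x
  define \<M> where "\<M> = {M. M \<subseteq> Y \<and> (\<forall>x\<in>M. \<forall>y\<in>M. x \<noteq> y \<longrightarrow> st x \<inter> st y = {})}"
  have "finite Y" using finite_subset[OF good(1) \<open>finite X\<close>] .
  then have "finite \<M>" by (intro finite_subset[of \<M> "Pow Y"]) (auto simp: \<M>_def)
  moreover have "\<M> \<noteq> {}" by (auto simp: \<M>_def)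
  ultimately have "\<exists>M\<in>\<M>. \<forall>M'\<in>\<M>. M \<subseteq> M' \<longrightarrow> M = M'"
    by (rule finite_has_maximal)
  then obtain M where M: "M \<in> \<M>" "\<And>M'. M' \<in> \<M> \<Longrightarrow> M \<subseteq> M' \<Longrightarrow> M = M'"
    by auto
  have MY: "M \<subseteq> Y" and dj: "\<And>x y. x \<in> M \<Longrightarrow> y \<in> M \<Longrightarrow> x \<noteq> y \<Longrightarrow> st x \<inter> st y = {}"
    using M(1) by (auto simp: \<M>_def)
  have "card (\<Union>x\<in>M. st x) = (\<Sum>x\<in>M. card (st x))"
    using dj finite_subset[OF MY \<open>finite Y\<close>] \<open>finite A\<close>
    by (intro card_UN_disjoint) (auto simp: st_def)
  also have "\<dots> = (\<Sum>x\<in>M. card A)"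
    using good(2) MY by (intro sum.cong) (auto simp: st_def card_image)
  finally have "card A * card M = card (\<Union>x\<in>M. st x)" by simp
  also have "\<dots> \<le> card X"
    using s MY good(1) by (intro card_mono \<open>finite X\<close>) (auto simp: st_def)
  finally have cM: "card A * card M \<le> card X" .
  have "\<exists>y\<in>M. st x \<inter> st y \<noteq> {}" if x: "x \<in> Y" for x
  proof (rule ccontr)
    assume n: "\<not> ?thesis"
    then have "insert x M \<in> \<M>" using MY dj x by (auto simp: \<M>_def)
    \<comment> \<open>So \<open>x\<close> is itself in \<open>M\<close>, and its nonempty star meets
      itself.\<close>
    then have "M = insert x M" using M(2) by blast
    moreover have "st x \<noteq> {}" using \<open>A \<noteq> {}\<close> by (simp add: st_def)
    ultimately show False using n by blast
  qed
  then obtain c where c: "\<And>x. x \<in> Y \<Longrightarrow> c x \<in> M" "\<And>x. x \<in> Y \<Longrightarrow> st x \<inter> st (c x) \<noteq> {}"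
    by metis
  have "\<exists>a\<in>A. \<exists>b\<in>A. s a x = s b (c x)" if "x \<in> Y" for x
    using c(2)[OF that] by (auto simp: st_def)
  then show ?thesis using that[of M c] MY cM c(1) by blast
qed

lemma card_coincidences:
  assumes "0 < n"
  shows "real (card {j \<in> {1..n}. \<sigma> j = \<tau> j}) = real n * (1 - hamming_dist n \<sigma> \<tau>)"
proof -
  have "card {j \<in> {1..n}. \<sigma> j = \<tau> j} + card {j \<in> {1..n}. \<sigma> j \<noteq> \<tau> j} = card ({j \<in> {1..n}. \<sigma> j = \<tau> j} \<union> {j \<in> {1..n}. \<sigma> j \<noteq> \<tau> j})"
    by (intro card_Un_disjoint[symmetric]) auto
  also have "{j \<in> {1..n}. \<sigma> j = \<tau> j} \<union> {j \<in> {1..n}. \<sigma> j \<noteq> \<tau> j} = {1..n}" by auto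
  finally have "real (card {j \<in> {1..n}. \<sigma> j = \<tau> j}) + real (card {j \<in> {1..n}. \<sigma> j \<noteq> \<tau> j}) = real n"
    by (simp flip: of_nat_add)
  then show ?thesis using assms by (simp add: hamming_dist_def right_diff_distrib)
qed

text \<open>A union bound over ordered pairs. For a fixed finite \<open>A\<close>, soficity sends
  each summand on the right to 0, so bad points have vanishing density.\<close>

lemma card_non_injective_le:
  assumes "finite A" "0 < n"
  shows "real (card {j \<in> {1..n}. \<not> inj_on (\<lambda>a. s a j) A})
    \<le> real n * (\<Sum>(a, b)\<in>{(a, b) \<in> A \<times> A. a \<noteq> b}. 1 - hamming_dist n (s a) (s b))"
proof -
  let ?P = "{(a, b) \<in> A \<times> A. a \<noteq> b}"
  have fP: "finite ?P" using assms by (auto intro: finite_subset[of _ "A \<times> A"])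
  have "card {j \<in> {1..n}. \<not> inj_on (\<lambda>a. s a j) A}
      \<le> card (\<Union>(a, b)\<in>?P. {j \<in> {1..n}. s a j = s b j})"
    using fP by (intro card_mono) (auto simp: inj_on_def)
  also have "\<dots> \<le> (\<Sum>p\<in>?P. card (case p of (a, b) \<Rightarrow> {j \<in> {1..n}. s a j = s b j}))"
    by (rule card_UN_le[OF fP])
  finally have "real (card {j \<in> {1..n}. \<not> inj_on (\<lambda>a. s a j) A})
      \<le> (\<Sum>p\<in>?P. real (card (case p of (a, b) \<Rightarrow> {j \<in> {1..n}. s a j = s b j})))"
    using of_nat_mono by fastforce
  also have "\<dots> = (\<Sum>(a, b)\<in>?P. real n * (1 - hamming_dist n (s a) (s b)))"
    using card_coincidences[OF assms(2)] by (intro sum.cong) auto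
  finally show ?thesis by (simp add: sum_distrib_left case_prod_beta)
qed

section \<open>Dimension of the l^p space and bounds on the \<epsilon>-dimension\<close>

lemma subspace_lp_space: "complex_vector.subspace (lp_space d)"
  by (auto simp: complex_vector.subspace_def lp_space_def scaleC_fun_def scaleC_complex_def)

text \<open>The point indicators form a basis; independence goes by induction, since all earlier
  ones vanish at \<open>Suc k\<close>.\<close>

lemma dim_lp_space: "complex_vector.dim (lp_space d) = d"
proof -
  define e :: "nat \<Rightarrow> nat \<Rightarrow> complex" where "e i = (\<lambda>j. if j = i then 1 else 0)" for i
  have inj: "inj_on e {1..d}" by (rule inj_onI) (metis e_def zero_neq_one)
  have sub: "complex_vector.span (e ` {1..k}) \<subseteq> lp_space k" for k
    by (intro complex_vector.span_minimal subspace_lp_space) (auto simp: lp_space_def e_def)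
  have ind: "complex_vector.independent (e ` {1..k})" for k
  proof (induction k)
    case 0
    show ?case by (simp add: complex_vector.independent_empty)
  next
    case (Suc k)
    have "e (Suc k) \<notin> lp_space k" by (auto simp: lp_space_def e_def)
    then show ?case
      using complex_vector.independent_insertI[OF _ Suc, of "e (Suc k)"] sub[of k]
      by (auto simp: atLeastAtMostSuc_conv)
  qed
  have "lp_space d \<subseteq> complex_vector.span (e ` {1..d})"
  proof
    fix f assume f: "f \<in> lp_space d"
    have "f = (\<Sum>i\<in>{1..d}. f i *\<^sub>C e i)"
    proof
      fix j
      have "(\<Sum>i\<in>{1..d}. f i *\<^sub>C e i) j = (\<Sum>i\<in>{1..d}. if i = j then f i else 0)"
        by (subst sum_fun_apply) (intro sum.cong, auto simp: scaleC_fun_def scaleC_complex_def e_def)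
      also have "\<dots> = (if j \<in> {1..d} then f j else 0)" by (rule sum.delta) simp
      also have "\<dots> = f j" using f by (auto simp: lp_space_def)
      finally show "f j = (\<Sum>i\<in>{1..d}. f i *\<^sub>C e i) j" ..
    qed
    also have "\<dots> \<in> complex_vector.span (e ` {1..d})"
      by (intro complex_vector.span_sum complex_vector.span_scale complex_vector.span_base) auto
    finally show "f \<in> complex_vector.span (e ` {1..d})" .
  qed
  then have "complex_vector.dim (lp_space d) = card (e ` {1..d})"
    using sub[of d] ind[of d] by (intro complex_vector.dim_unique[of "e ` {1..d}"])
      (auto intro: complex_vector.span_base)
  then show ?thesis using card_image[OF inj] by simp
qed

text \<open>Generators need not be independent, which later allows empty clusters.\<close>

lemma eps_dim_le_card:
  assumes "finite B" "complex_vector.span B \<subseteq> X"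
    "\<And>a. a \<in> A \<Longrightarrow> \<exists>u\<in>complex_vector.span B. r (a - u) < \<epsilon>"
  shows "eps_dim \<epsilon> X A r \<le> ereal (card B)"
proof -
  have "eps_dim \<epsilon> X A r \<le> ereal (real (complex_vector.dim (complex_vector.span B)))"
    unfolding eps_dim_def using assms by (intro INF_lower) (auto simp: fin_dim_def)
  also have "complex_vector.dim (complex_vector.span B) \<le> card B"
    using assms(1) by (intro complex_vector.dim_le_card) auto
  finally show ?thesis by simp
qed

lemma eps_dim_nonneg: "0 \<le> eps_dim \<epsilon> X A r"
  unfolding eps_dim_def by (intro INF_greatest) simp

section \<open>Almost invariant functions and their clusters\<close>

text \<open>
  Every point \<open>j\<close> at which the permutations \<open>s a\<close> take distinct values is moved to the centre
  \<open>c j\<close> of a star by two steps through a common point. Composing the defect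
  \<open>f - perm_op (s b) f\<close> with \<open>s a\<close> does not change its norm, so the passage
  from \<open>f\<close> to \<open>f \<circ> c\<close> costs boundedly many defects, at a price independent of \<open>d\<close>.
\<close>

lemma invariant_clusters:
  assumes "0 < d" "finite A" "A \<noteq> {}" and s: "\<And>a. a \<in> A \<Longrightarrow> s a permutes {1..d}"
  obtains R c where "finite R" "\<And>j. j \<in> {1..d} \<Longrightarrow> c j \<in> R"
    "real (card R) \<le> real d / card A + card {j \<in> {1..d}. \<not> inj_on (\<lambda>a. s a j) A}"
    "\<And>p f t. 1 \<le> p \<Longrightarrow> 0 \<le> t \<Longrightarrow> (\<And>a. a \<in> A \<Longrightarrow> lp_norm p d (f - perm_op (s a) f) \<le> t) \<Longrightarrow>
      lp_norm p d (f - (\<lambda>j. if j \<in> {1..d} then f (c j) else 0)) \<le> 2 * (real (card A))\<^sup>2 * t"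
proof -
  define Y where "Y = {j \<in> {1..d}. inj_on (\<lambda>a. s a j) A}"
  let ?N = "{j \<in> {1..d}. \<not> inj_on (\<lambda>a. s a j) A}"
  have perm: "s a j \<in> {1..d}" if "a \<in> A" "j \<in> {1..d}" for a j
    using permutes_in_image[OF s[OF that(1)]] that(2) by blast
  obtain M c where M: "M \<subseteq> Y" "card A * card M \<le> card {1..d}"
    and c: "\<And>j. j \<in> Y \<Longrightarrow> c j \<in> M" "\<And>j. j \<in> Y \<Longrightarrow> \<exists>a\<in>A. \<exists>b\<in>A. s a j = s b (c j)"
    by (rule disjoint_stars[of "{1..d}" A s Y]) (use assms perm in \<open>auto simp: Y_def\<close>)
  have A: "0 < card A" using assms by (simp add: card_gt_0_iff)
  \<comment> \<open>Bad points are their own centres; this is the second term in the bound on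
    \<open>card R\<close>.\<close>
  define c' where "c' j = (if j \<in> Y then c j else j)" for j
  show ?thesis
  proof (rule that[of "M \<union> ?N" c'])
    have fM: "finite M" using M(1) by (rule finite_subset) (simp add: Y_def)
    then show "finite (M \<union> ?N)" by simp
    show "c' j \<in> M \<union> ?N" if "j \<in> {1..d}" for j
      using that c(1)[of j] by (auto simp: c'_def Y_def)
    have "card (M \<union> ?N) \<le> card M + card ?N" by (rule card_Un_le)
    moreover have "real (card M) \<le> real d / card A"
      using M(2) A by (simp add: field_simps flip: of_nat_mult)
    ultimately show "real (card (M \<union> ?N)) \<le> real d / card A + card ?N" by linarith
  next
    fix p :: ereal and f :: "nat \<Rightarrow> complex" and t :: real
    assume p: "1 \<le> p" and t: "0 \<le> t"
      and inv: "\<And>a. a \<in> A \<Longrightarrow> lp_norm p d (f - perm_op (s a) f) \<le> t"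
    \<comment> \<open>The defect of \<open>s b\<close> read off at \<open>s a j\<close>: for
      \<open>s a j = s b (c j)\<close> it equals \<open>f (s a j) - f (c j)\<close>, and for
      \<open>b = a\<close> it equals \<open>f (s a j) - f j\<close>. Subtracting eliminates the
      common point.\<close>
    define h where "h = (\<lambda>(a, b) j. (f - perm_op (s b) f) (s a j))"
    have D: "(f - perm_op (s b) f) (s b j) = f (s b j) - f j" if "b \<in> A" for b j
      using permutes_inj[OF s[OF that]] by (simp add: perm_op_def)
    have "lp_norm p d (f - (\<lambda>j. if j \<in> {1..d} then f (c' j) else 0)) \<le> 2 * real (card (A \<times> A)) * t"
    proof (rule lp_norm_le[where h = h, OF p \<open>0 < d\<close> _ _ t])
      show "finite (A \<times> A)" using \<open>finite A\<close> by simp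
      show "(0::real) \<le> 2" by simp
      fix k assume "k \<in> A \<times> A"
      then obtain a b where ab: "k = (a, b)" "a \<in> A" "b \<in> A" by blast
      show "lp_norm p d (h k) \<le> t"
        using inv[OF ab(3)] lp_norm_permute[OF s[OF ab(2)], of p "f - perm_op (s b) f"]
        by (simp only: h_def ab(1) prod.case)
    next
      fix j assume j: "j \<in> {1..d}"
      show "\<exists>k\<in>A \<times> A. cmod ((f - (\<lambda>j. if j \<in> {1..d} then f (c' j) else 0)) j) \<le> 2 * cmod (h k j)"
      proof (cases "j \<in> Y")
        case True
        then obtain a b where ab: "a \<in> A" "b \<in> A" "s a j = s b (c j)" using c(2) by blast
        have "f j - f (c j) = h (a, b) j - h (a, a) j"
          using D[OF ab(1), of j] D[OF ab(2), of "c j"] ab(3) by (simp add: h_def)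
        then have "cmod (f j - f (c j)) \<le> cmod (h (a, b) j) + cmod (h (a, a) j)"
          using norm_triangle_ineq4 by metis
        then have "cmod (f j - f (c j)) \<le> 2 * cmod (h (a, b) j) \<or> cmod (f j - f (c j)) \<le> 2 * cmod (h (a, a) j)"
          by linarith
        then show ?thesis using ab j True by (auto simp: c'_def)
      next
        case False
        then show ?thesis using \<open>A \<noteq> {}\<close> j by (auto simp: c'_def)
      qed
    qed
    then show "lp_norm p d (f - (\<lambda>j. if j \<in> {1..d} then f (c' j) else 0)) \<le> 2 * (real (card A))\<^sup>2 * t"
      by (simp add: card_cartesian_product power2_eq_square)
  qed
qed

section \<open>Almost equivariant maps\<close>

text \<open>Contractivity gives \<open>T (\<pi> a (x n))\<close> close to \<open>T (x n)\<close>,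
  and almost equivariance on the one-letter word \<open>[a]\<close> gives it close to the permuted
  \<open>T (x n)\<close>. Adding two errors \<open>\<delta>\<close> costs the factor 4 of
  \<open>lp_norm_add_le\<close>.\<close>

lemma Hom_almost_invariant:
  assumes "0 < d" "1 \<le> p" and F: "\<one>\<^bsub>G\<^esub> \<in> F" "a \<in> F" and one: "\<pi> \<one>\<^bsub>G\<^esub> (x n) = x n"
    and T: "T \<in> Hom_almost \<pi> x F m \<delta>' (lp_space d) (lp_norm p d) (\<lambda>g. perm_op (s g))"
    and "n < m" "\<delta>' \<le> \<delta>" "0 \<le> \<delta>" and near: "norm (\<pi> a (x n) - x n) \<le> \<delta>"
  shows "lp_norm p d (T (x n)) \<le> norm (x n)"
    "lp_norm p d (T (x n) - perm_op (s a) (T (x n))) \<le> 4 * \<delta>"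
proof -
  let ?V = "word_span \<pi> x F m"
  have w: "[g] \<in> words F m" if "g \<in> F" for g
    using that \<open>n < m\<close> by (auto simp: words_def)
  have V: "\<pi> g (x n) \<in> ?V" if "g \<in> F" for g
    unfolding word_span_def
    by (rule complex_vector.span_base) (use w[OF that] \<open>n < m\<close> in \<open>force intro: exI[of _ "[g]"]\<close>)
  \<comment> \<open>Words are nonempty, so \<open>x n\<close> enters the domain through the
    one-letter word of the identity.\<close>
  have xV: "x n \<in> ?V" using V[OF F(1)] one by simp
  have T1: "complex_linear_on ?V T"
    "\<And>v. v \<in> ?V \<Longrightarrow> lp_norm p d (T v) \<le> norm v"
    "\<And>gs j. gs \<in> words F m \<Longrightarrow> j < m \<Longrightarrow>
      lp_norm p d (T (foldr \<pi> gs (x j)) - foldr (\<lambda>g. perm_op (s g)) gs (T (x j))) < \<delta>'"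
    using T by (auto simp: Hom_almost_def)
  show "lp_norm p d (T (x n)) \<le> norm (x n)"
    using T1(2) xV by auto
  have sub: "complex_vector.subspace ?V" unfolding word_span_def by (rule complex_vector.subspace_span)
  let ?w = "(-1) *\<^sub>C \<pi> a (x n)"
  have wV: "?w \<in> ?V" by (rule complex_vector.subspace_scale[OF sub V[OF F(2)]])
  have "T (x n + ?w) = T (x n) + T ?w" "T ?w = (-1) *\<^sub>C T (\<pi> a (x n))"
    using T1(1) xV wV V[OF F(2)] unfolding complex_linear_on_def by blast+
  then have e: "T (x n + ?w) = T (x n) - T (\<pi> a (x n))"
    by (simp only: fun_eq_iff) (simp add: scaleC_fun_def scaleC_complex_def)
  have "lp_norm p d (T (x n + ?w)) \<le> norm (x n + ?w)"
    using complex_vector.subspace_add[OF sub xV wV] T1(2) by blast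
  also have "norm (x n + ?w) \<le> \<delta>"
    using near by (simp add: scaleC_one norm_minus_commute)
  finally have 1: "lp_norm p d (T (x n) - T (\<pi> a (x n))) \<le> \<delta>" by (simp only: e)
  have 2: "lp_norm p d (T (\<pi> a (x n)) - perm_op (s a) (T (x n))) \<le> \<delta>"
    using T1(3)[OF w[OF F(2)] \<open>n < m\<close>] \<open>\<delta>' \<le> \<delta>\<close> by simp
  show "lp_norm p d (T (x n) - perm_op (s a) (T (x n))) \<le> 4 * \<delta>"
    using lp_norm_add_le[OF \<open>1 \<le> p\<close> \<open>0 < d\<close> \<open>0 \<le> \<delta>\<close> 1 2] by simp
qed

text \<open>The approximating space consists of sequences that are constant on clusters in the first
  \<open>K\<close> coordinates and 0 afterwards, so \<open>K * card R\<close> generators suffice.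
  The 8 is the 2 of \<open>invariant_clusters\<close> times the 4 of
  \<open>Hom_almost_invariant\<close>; past \<open>K\<close> the contraction bound \<open>C\<close>
  is enough for \<open>\<rho>\<close>.\<close>

lemma eps_dim_Hom_almost_le:
  fixes K :: nat
  assumes "0 < d" "1 \<le> p" "finite A" "A \<noteq> {}" and s: "\<And>a. a \<in> A \<Longrightarrow> s a permutes {1..d}"
    and F: "\<one>\<^bsub>G\<^esub> \<in> F" "A \<subseteq> F" and one: "\<And>v. \<pi> \<one>\<^bsub>G\<^esub> v = v"
    and C: "\<And>n. norm (x n) \<le> C" and near: "\<And>a n. a \<in> A \<Longrightarrow> norm (\<pi> a (x n) - x n) \<le> \<delta>"
    and \<delta>: "0 \<le> \<delta>" "\<delta>' \<le> \<delta>" "8 * (real (card A))\<^sup>2 * \<delta> \<le> r"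
    and \<rho>: "\<And>f. (\<And>n. 0 \<le> f n) \<Longrightarrow> (\<And>n. n < K \<Longrightarrow> f n \<le> r) \<Longrightarrow> (\<And>n. n \<ge> K \<Longrightarrow> f n \<le> C) \<Longrightarrow>
      \<rho> (\<lambda>n. complex_of_real (f n)) < \<epsilon>"
  shows "eps_dim \<epsilon> (linf (lp_space d) (lp_norm p d))
      (alpha_map x m ` Hom_almost \<pi> x F m \<delta>' (lp_space d) (lp_norm p d) (\<lambda>g. perm_op (s g)))
      (vector_product_norm \<rho> (lp_norm p d))
    \<le> ereal (K * (real d / card A + card {j \<in> {1..d}. \<not> inj_on (\<lambda>a. s a j) A}))"
proof -
  obtain R c where R: "finite R" "\<And>j. j \<in> {1..d} \<Longrightarrow> c j \<in> R"
    "real (card R) \<le> real d / card A + card {j \<in> {1..d}. \<not> inj_on (\<lambda>a. s a j) A}"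
    and cl: "\<And>p f t. 1 \<le> p \<Longrightarrow> 0 \<le> t \<Longrightarrow> (\<And>a. a \<in> A \<Longrightarrow> lp_norm p d (f - perm_op (s a) f) \<le> t) \<Longrightarrow>
      lp_norm p d (f - (\<lambda>j. if j \<in> {1..d} then f (c j) else 0)) \<le> 2 * (real (card A))\<^sup>2 * t"
    by (rule invariant_clusters[OF assms(1,3,4) s]) (assumption | blast)+
  have r0: "0 \<le> r" by (rule order.trans[OF _ \<delta>(3)]) (use \<delta>(1) in simp)
  have C0: "0 \<le> C" using C[of 0] norm_ge_zero order.trans by blast
  \<comment> \<open>\<open>b (n, k)\<close> is the indicator of the cluster with centre
    \<open>k\<close>, placed in coordinate \<open>n\<close>.\<close>
  define b :: "nat \<times> nat \<Rightarrow> nat \<Rightarrow> nat \<Rightarrow> complex" where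
    "b = (\<lambda>(n, k) n' j. if n' = n \<and> j \<in> {1..d} \<and> c j = k then 1 else 0)"
  define B where "B = b ` ({..<K} \<times> R)"
  \<comment> \<open>An intermediate subspace: with only \<open>K\<close> nonzero coordinates,
    boundedness follows from a finite sum of norms.\<close>
  define S where "S = {f :: nat \<Rightarrow> nat \<Rightarrow> complex. (\<forall>n. f n \<in> lp_space d) \<and> (\<forall>n\<ge>K. f n = 0)}"
  have fB: "finite B" using R(1) by (simp add: B_def)
  have "complex_vector.subspace S"
    using complex_vector.subspace_0[OF subspace_lp_space] complex_vector.subspace_add[OF subspace_lp_space]
      complex_vector.subspace_scale[OF subspace_lp_space]
    by (auto simp: complex_vector.subspace_def S_def)
       (auto simp: scaleC_fun_def zero_fun_def scaleC_complex_def lp_space_def)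
  moreover have "B \<subseteq> S" by (auto simp: B_def S_def b_def lp_space_def zero_fun_def)
  ultimately have "complex_vector.span B \<subseteq> S" by (intro complex_vector.span_minimal)
  also have "S \<subseteq> linf (lp_space d) (lp_norm p d)"
  proof
    fix f assume f: "f \<in> S"
    have "lp_norm p d (f n) \<le> (\<Sum>n<K. lp_norm p d (f n))" for n
    proof (cases "n < K")
      case True
      then show ?thesis
        using lp_norm_nonneg[OF \<open>0 < d\<close>] by (intro member_le_sum[of n "{..<K}" "\<lambda>n. lp_norm p d (f n)"]) auto
    next
      case False
      then show ?thesis using f lp_norm_nonneg[OF \<open>0 < d\<close>]
        by (auto simp: S_def lp_norm_0[OF \<open>0 < d\<close>] intro: sum_nonneg)
    qed
    then show "f \<in> linf (lp_space d) (lp_norm p d)" using f by (auto simp: linf_def S_def)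
  qed
  finally have BL: "complex_vector.span B \<subseteq> linf (lp_space d) (lp_norm p d)" .
  have "eps_dim \<epsilon> (linf (lp_space d) (lp_norm p d))
      (alpha_map x m ` Hom_almost \<pi> x F m \<delta>' (lp_space d) (lp_norm p d) (\<lambda>g. perm_op (s g)))
      (vector_product_norm \<rho> (lp_norm p d)) \<le> ereal (card B)"
  proof (rule eps_dim_le_card[OF fB BL])
    fix f assume "f \<in> alpha_map x m ` Hom_almost \<pi> x F m \<delta>' (lp_space d) (lp_norm p d) (\<lambda>g. perm_op (s g))"
    then obtain T where T: "T \<in> Hom_almost \<pi> x F m \<delta>' (lp_space d) (lp_norm p d) (\<lambda>g. perm_op (s g))"
      and f: "f = alpha_map x m T" by blast
    define u where "u n = (if n < K then (\<lambda>j. if j \<in> {1..d} then f n (c j) else 0) else 0)" for n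
    obtain a0 where a0: "a0 \<in> A" using \<open>A \<noteq> {}\<close> by blast
    \<comment> \<open>The coefficient at \<open>(n, k)\<close> is the value of \<open>f n\<close> at
      the centre \<open>k\<close>.\<close>
    have "u = (\<Sum>(n, k)\<in>{..<K} \<times> R. f n k *\<^sub>C b (n, k))"
    proof (intro ext)
      fix n j
      have "(\<Sum>(n', k)\<in>{..<K} \<times> R. f n' k *\<^sub>C b (n', k)) n j
          = (\<Sum>q\<in>{..<K} \<times> R. if q = (n, c j) then (if j \<in> {1..d} then f n (c j) else 0) else 0)"
        unfolding sum_fun_apply
        by (intro sum.cong) (auto simp: b_def scaleC_fun_def scaleC_complex_def split: if_splits)
      also have "\<dots> = (if (n, c j) \<in> {..<K} \<times> R then (if j \<in> {1..d} then f n (c j) else 0) else 0)"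
        using R(1) by (intro sum.delta) simp
      also have "\<dots> = u n j" using R(2)[of j] by (auto simp: u_def)
      finally show "u n j = (\<Sum>(n', k)\<in>{..<K} \<times> R. f n' k *\<^sub>C b (n', k)) n j" ..
    qed
    also have "\<dots> \<in> complex_vector.span B"
      unfolding case_prod_beta
      by (intro complex_vector.span_sum complex_vector.span_scale complex_vector.span_base)
        (auto simp: B_def)
    finally have uB: "u \<in> complex_vector.span B" .
    have "\<rho> (\<lambda>n. complex_of_real (lp_norm p d ((f - u) n))) < \<epsilon>"
    proof (rule \<rho>)
      show "0 \<le> lp_norm p d ((f - u) n)" for n by (rule lp_norm_nonneg[OF \<open>0 < d\<close>])
    next
      fix n assume n: "n < K"
      show "lp_norm p d ((f - u) n) \<le> r"
      proof (cases "n < m")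
        case True
        have fn: "f n = T (x n)" using True by (simp add: f alpha_map_def)
        have inv: "lp_norm p d (f n - perm_op (s a) (f n)) \<le> 4 * \<delta>" if "a \<in> A" for a
          unfolding fn using F(2) that
          by (intro Hom_almost_invariant(2)[OF assms(1,2) F(1) _ one T True \<delta>(2,1) near]) auto
        have "lp_norm p d (f n - (\<lambda>j. if j \<in> {1..d} then f n (c j) else 0)) \<le> 2 * (real (card A))\<^sup>2 * (4 * \<delta>)"
          using \<delta>(1) inv by (intro cl assms(2)) auto
        also have "\<dots> \<le> r" using \<delta>(3) by simp
        finally show ?thesis using n by (simp add: u_def)
      next
        \<comment> \<open>For \<open>m \<le> n\<close> the map \<open>alpha_map\<close> gives 0, and
          then \<open>u n\<close> is 0 as well.\<close>
        case False
        then have "(f - u) n = 0" by (auto simp: f alpha_map_def u_def fun_eq_iff)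
        then show ?thesis using r0 by (simp add: lp_norm_0[OF \<open>0 < d\<close>])
      qed
    next
      fix n assume n: "n \<ge> K"
      show "lp_norm p d ((f - u) n) \<le> C"
      proof (cases "n < m")
        case True
        then have "(f - u) n = T (x n)" using n by (simp add: f alpha_map_def u_def)
        moreover have "lp_norm p d (T (x n)) \<le> norm (x n)"
          using Hom_almost_invariant(1)[OF assms(1,2) F(1) _ one T True \<delta>(2,1) near[OF a0]] F(2) a0 by blast
        ultimately show ?thesis using C[of n] by simp
      next
        case False
        then have "(f - u) n = 0" using n by (auto simp: f alpha_map_def u_def)
        then show ?thesis using C0 by (simp add: lp_norm_0[OF \<open>0 < d\<close>])
      qed
    qed
    then show "\<exists>u\<in>complex_vector.span B. vector_product_norm \<rho> (lp_norm p d) (f - u) < \<epsilon>"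
      using uB by (auto simp: vector_product_norm_def)
  qed
  also have "real (card B) \<le> K * real (card R)"
    using card_image_le[of "{..<K} \<times> R" b] R(1) by (simp add: B_def flip: of_nat_mult)
  also have "\<dots> \<le> K * (real d / card A + card {j \<in> {1..d}. \<not> inj_on (\<lambda>a. s a j) A})"
    using R(3) by (intro mult_left_mono) auto
  finally show ?thesis by simp
qed

section \<open>Nonnegativity and the passage to the limit\<close>

text \<open>Each supremum includes the triple \<open>t0\<close> itself; an empty one would be minus
  infinity.\<close>

lemma limsup_triples_nonneg:
  assumes "\<And>F m \<delta>. 0 \<le> \<phi> F m \<delta>"
  shows "0 \<le> limsup_triples G \<phi>"
  unfolding limsup_triples_def
proof (rule INF_greatest)
  fix t0 assume t0: "t0 \<in> triples G"
  then have "t0 \<in> {t \<in> triples G. triple_le t0 t}" by (auto simp: triple_le_def)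
  then show "0 \<le> (SUP (F, m, \<delta>) \<in> {t \<in> triples G. triple_le t0 t}. \<phi> F m \<delta>)"
    by (rule SUP_upper2) (use assms in \<open>auto split: prod.splits\<close>)
qed

theorem theorem2p1:
  fixes G :: "('g, 'm) monoid_scheme"
    and d :: "nat \<Rightarrow> nat" and \<sigma> :: "nat \<Rightarrow> 'g \<Rightarrow> nat \<Rightarrow> nat"
    and p :: ereal
    and \<pi> :: "'g \<Rightarrow> 'v \<Rightarrow> 'v::complex_banach"
    and x :: "nat \<Rightarrow> 'v" and \<rho> :: "(nat \<Rightarrow> complex) \<Rightarrow> real"
  assumes "group G" and "countable (carrier G)" and "infinite (carrier G)"
    and "sofic_group G"
    and "sofic_approximation G d \<sigma>"
    and "1 \<le> p"
    and "fin_dim (UNIV :: 'v set)"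
    and "uniformly_bounded_action G \<pi>"
    and "bounded (range x)" and "dynamically_generating G \<pi> x"
    and "product_norm \<rho>"
  shows "dim_Sigma_lp G \<pi> x \<rho> p d \<sigma> = 0"
proof -
  define E where "E \<epsilon> F m \<delta> i = eps_dim \<epsilon> (linf (lp_space (d i)) (lp_norm p (d i)))
        (alpha_map x m ` Hom_almost \<pi> x F m \<delta> (lp_space (d i)) (lp_norm p (d i)) (\<lambda>g. perm_op (\<sigma> i g)))
        (vector_product_norm \<rho> (lp_norm p (d i)))
      / ereal (real (d i))" for \<epsilon> F m \<delta> i
  have dim: "dim_Sigma_lp G \<pi> x \<rho> p d \<sigma> = (SUP \<epsilon> \<in> {0<..}. limsup_triples G (\<lambda>F m \<delta>. limsup (E \<epsilon> F m \<delta>)))"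
    by (simp add: dim_Sigma_lp_def dim_Sigma_def dim_lp_space E_def[abs_def])
  have d0: "0 < d i" and perm: "g \<in> carrier G \<Longrightarrow> \<sigma> i g permutes {1..d i}"
    and ham: "g \<in> carrier G \<Longrightarrow> h \<in> carrier G \<Longrightarrow> g \<noteq> h \<Longrightarrow>
      (\<lambda>i. hamming_dist (d i) (\<sigma> i g) (\<sigma> i h)) \<longlonglongrightarrow> 1" for i g h
    using assms(5) by (auto simp: sofic_approximation_def)
  have E0: "0 \<le> E \<epsilon> F m \<delta> i" for \<epsilon> F m \<delta> i
    unfolding E_def using d0[of i] by (intro zero_le_divide_ereal eps_dim_nonneg) auto
  have ga: "group_action G UNIV \<pi>" using assms(8) by (simp add: uniformly_bounded_action_def)
  have one: "\<pi> \<one>\<^bsub>G\<^esub> v = v" for v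
    using fun_cong[OF group_action.id_eq_one[OF ga], of v] by simp
  obtain C0 where C0: "\<And>n. norm (x n) \<le> C0" using assms(9) by (auto simp: bounded_iff)
  define C where "C = max C0 1"
  have C: "norm (x n) \<le> C" "C > 0" for n using C0[of n] by (auto simp: C_def)
  have main: "limsup_triples G (\<lambda>F m \<delta>. limsup (E \<epsilon> F m \<delta>)) \<le> ereal \<theta>" if "\<epsilon> > 0" "\<theta> > 0" for \<epsilon> \<theta>
  proof -
    \<comment> \<open>The order of choices matters: \<open>K\<close> and \<open>r\<close> depend
      only on \<open>\<epsilon>\<close>, \<open>C\<close> and \<open>\<rho>\<close>; then
      \<open>N\<close> is chosen from \<open>K\<close> and \<open>\<theta>\<close>, and
      \<open>\<delta>\<close> from \<open>r\<close> and \<open>N\<close>.\<close>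
    obtain K :: nat and r :: real where K: "r > 0"
      "\<And>f. (\<And>n. 0 \<le> f n) \<Longrightarrow> (\<And>n. n < K \<Longrightarrow> f n \<le> r) \<Longrightarrow> (\<And>n. n \<ge> K \<Longrightarrow> f n \<le> C) \<Longrightarrow>
        \<rho> (\<lambda>n. complex_of_real (f n)) < \<epsilon>"
      by (rule product_norm_small[OF assms(11) \<open>\<epsilon> > 0\<close> C(2)]) (rule that; blast)
    obtain N where N: "real N > K / \<theta>" using reals_Archimedean2 by blast
    then have N0: "N > 0" using \<open>\<theta> > 0\<close> by (metis divide_nonneg_pos gr0I not_less of_nat_0 of_nat_0_le_iff)
    have KN: "K / real N < \<theta>" using N N0 \<open>\<theta> > 0\<close> by (simp add: field_simps)
    \<comment> \<open>Solves \<open>8 * N^2 * \<delta> = r\<close>, the smallness required by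
      \<open>eps_dim_Hom_almost_le\<close>.\<close>
    define \<delta> where "\<delta> = r / (8 * (real N)\<^sup>2)"
    have \<delta>: "\<delta> > 0" using K(1) N0 by (simp add: \<delta>_def)
    obtain A where A: "finite A" "card A = N"
      "A \<subseteq> {h \<in> carrier G. \<forall>v\<in>cball 0 C. norm (\<pi> h v - v) \<le> \<delta>}"
      using infinite_near_identity[OF assms(1,3,7,8) \<delta>] infinite_arbitrarily_large by blast
    have AG: "A \<subseteq> carrier G" and near: "\<And>a n. a \<in> A \<Longrightarrow> norm (\<pi> a (x n) - x n) \<le> \<delta>"
      using A(3) C(1) by auto
    have A0: "A \<noteq> {}" using A(2) N0 by auto
    let ?P = "{(a, b) \<in> A \<times> A. a \<noteq> b}"
    \<comment> \<open>The dimension bound divided by \<open>d i\<close>; the sum is finite with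
      terms tending to 0, leaving \<open>K / N\<close> in the limit.\<close>
    define \<beta> where "\<beta> i = K * (1 / N + (\<Sum>(a, b)\<in>?P. 1 - hamming_dist (d i) (\<sigma> i a) (\<sigma> i b)))" for i
    have "\<beta> \<longlonglongrightarrow> K * (1 / N + (\<Sum>(a, b)\<in>?P. 1 - 1))"
      unfolding \<beta>_def[abs_def] case_prod_beta using AG
      by (intro tendsto_intros ham) auto
    then have "\<beta> \<longlonglongrightarrow> K / N" by (simp add: case_prod_beta)
    then have "\<forall>\<^sub>F i in sequentially. \<beta> i < \<theta>" using KN by (rule order_tendstoD)
    \<comment> \<open>The value 1 for \<open>m\<close> suffices, because coordinates from
      \<open>m\<close> on vanish under \<open>alpha_map\<close>.\<close>
    define t0 where "t0 = (insert \<one>\<^bsub>G\<^esub> A, 1::nat, \<delta>)"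
    have t0: "t0 \<in> triples G"
      using A(1) AG \<delta> group.is_monoid[OF assms(1)] by (auto simp: t0_def triples_def)
    have "limsup (E \<epsilon> F m \<delta>') \<le> ereal \<theta>" if t: "(F, m, \<delta>') \<in> triples G" "triple_le t0 (F, m, \<delta>')" for F m \<delta>'
    proof (rule Limsup_bounded)
      have F: "\<one>\<^bsub>G\<^esub> \<in> F" "A \<subseteq> F" "\<delta>' \<le> \<delta>" using t by (auto simp: t0_def triple_le_def)
      have "E \<epsilon> F m \<delta>' i \<le> ereal (\<beta> i)" for i
      proof -
        have "E \<epsilon> F m \<delta>' i \<le> ereal (K * (real (d i) / card A + card {j \<in> {1..d i}. \<not> inj_on (\<lambda>a. \<sigma> i a j) A})) / ereal (d i)"
          unfolding E_def
        proof (intro ereal_divide_right_mono eps_dim_Hom_almost_le[where G = G and r = r and C = C and \<delta> = \<delta>])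
          show "8 * (real (card A))\<^sup>2 * \<delta> \<le> r" using A(2) N0 by (simp add: \<delta>_def)
        qed (use d0 assms(6) A A0 F one C near \<delta> K(2) perm AG in auto)
        also have "\<dots> = ereal (K * (1 / N + card {j \<in> {1..d i}. \<not> inj_on (\<lambda>a. \<sigma> i a j) A} / d i))"
          using d0[of i] A(2) by (simp add: field_simps)
        also have "\<dots> \<le> ereal (\<beta> i)"
          using card_non_injective_le[OF A(1) d0[of i], of "\<sigma> i"] d0[of i] unfolding \<beta>_def ereal_less_eq
          by (intro mult_left_mono add_left_mono) (auto simp: divide_le_eq mult.commute)
        finally show ?thesis .
      qed
      then show "\<forall>\<^sub>F i in sequentially. E \<epsilon> F m \<delta>' i \<le> ereal \<theta>"
        by (intro eventually_mono[OF \<open>\<forall>\<^sub>F i in sequentially. \<beta> i < \<theta>\<close>])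
          (meson ereal_less_eq(3) less_imp_le order_trans)
    qed
    then show ?thesis
      unfolding limsup_triples_def by (intro INF_lower2[OF t0] SUP_least) auto
  qed
  have "limsup_triples G (\<lambda>F m \<delta>. limsup (E \<epsilon> F m \<delta>)) = 0" if "\<epsilon> > 0" for \<epsilon>
  proof (rule antisym)
    show "limsup_triples G (\<lambda>F m \<delta>. limsup (E \<epsilon> F m \<delta>)) \<le> 0"
      by (rule ereal_le_epsilon2) (use main[OF that] in auto)
    show "0 \<le> limsup_triples G (\<lambda>F m \<delta>. limsup (E \<epsilon> F m \<delta>))"
      by (intro limsup_triples_nonneg le_Limsup) (use E0 in auto)
  qed
  then show ?thesis unfolding dim by (simp add: cSUP_const)
qed

end
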